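(* Let $R$ be a symmetric nonnegative real $n\times n$ matrix with maximum density $\kappa$, and let $\alpha=\|R\|_1$. Then there exists a nonnegative real $n\times n$ matrix $B$ such that $R=B+B^{\mathrm T}$ and $\|B\|_1=\kappa$, $\|B\|_\infty=\alpha-\kappa$.
   Context: $\|\cdot\|_1$ is the maximum (absolute) column sum and $\|\cdot\|_\infty$ the maximum (absolute) row sum of a matrix. The maximum density of a nonnegative $n\times n$ matrix $R=(\varrho_{ij})$ is $\kappa(R)=\max_{\emptyset\ne I\subseteq[n]}\ \frac{1}{2|I|}\sum_{i,j\in I}\varrho_{ij}$. *)

theory Defs
  imports "HOL-Analysis.Analysis"
begin

text \<open>In \<^typ>\<open>real ^ 'n ^ 'm\<close>, the entry in row i and column j is A $ i $ j.\<close>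

definition matrix_norm_1 :: "real ^ 'n ^ 'm \<Rightarrow> real" where
  "matrix_norm_1 A = (MAX j. \<Sum>i\<in>UNIV. \<bar>A $ i $ j\<bar>)"

definition matrix_norm_inf :: "real ^ 'n ^ 'm \<Rightarrow> real" where
  "matrix_norm_inf A = (MAX i. \<Sum>j\<in>UNIV. \<bar>A $ i $ j\<bar>)"

definition nonneg_matrix :: "real ^ 'n ^ 'm \<Rightarrow> bool" where
  "nonneg_matrix A \<longleftrightarrow> (\<forall>i j. 0 \<le> A $ i $ j)"

definition max_density :: "real ^ 'n ^ 'n \<Rightarrow> real" where
  "max_density R =
     (MAX I \<in> {I :: 'n set. I \<noteq> {}}. 1 / (2 * real (card I)) * (\<Sum>i\<in>I. \<Sum>j\<in>I. R $ i $ j))"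

end

theory Submission
  imports Defs
begin

text \<open>
  Read \<open>R\<close> as a weighted graph in which the pair \<open>i, j\<close> has weight \<open>R $ i $ j\<close> and \<open>i\<close> carries a
  loop of weight \<open>R $ i $ i / 2\<close>.  A nonnegative \<open>B\<close> with \<open>R = B + transpose B\<close> is a fractional
  orientation; its column and row sums are in- and out-degrees, and at every vertex they add up to
  the degree, which is at most \<open>\<alpha>\<close>.  The total weight inside a vertex set \<open>I\<close> is at most
  \<open>\<kappa> * card I\<close>, and \<open>\<kappa> \<le> \<alpha> / 2\<close>, so it is also at most \<open>(\<alpha> - \<kappa>) * card I\<close>.

  The core is \<open>bounded_orientation_exists\<close>: if \<open>p\<close> and \<open>q\<close> both bound the weight per vertex inside
  every set and \<open>p + q\<close> bounds the degrees, then some orientation has in-degrees at most \<open>p\<close> and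
  out-degrees at most \<open>q\<close>.  Take an orientation that minimizes the sum of the squares of all
  excesses over these two bounds, which exists by compactness.  If a vertex had in-degree
  above \<open>p\<close>, let \<open>I\<close> be the set of all such vertices.  Weight oriented from outside into \<open>I\<close> could
  be partly reversed, lowering the penalty (\<open>penalty_reverse_less\<close>); here \<open>p + q\<close> bounding the
  degrees ensures that no vertex exceeds both bounds.  So no weight enters \<open>I\<close>, its
  in-degrees add up to the weight inside \<open>I\<close>, and this is at most \<open>p * card I\<close>, a contradiction.
  Out-degrees are treated in the same way.

  With \<open>p = \<kappa>\<close> and \<open>q = \<alpha> - \<kappa>\<close> both bounds are attained: the first because in-degrees on a densest
  set average at least \<open>\<kappa>\<close>, the second at a vertex of degree \<open>\<alpha>\<close>.
\<close>

definition col_sum :: "real ^ 'n ^ 'm \<Rightarrow> 'n \<Rightarrow> real" where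
  "col_sum A j = (\<Sum>i\<in>UNIV. A $ i $ j)"

definition row_sum :: "real ^ 'n ^ 'm \<Rightarrow> 'm \<Rightarrow> real" where
  "row_sum A i = (\<Sum>j\<in>UNIV. A $ i $ j)"

text \<open>The total weight inside \<open>I\<close>: a pair of distinct vertices is counted twice in the double sum.\<close>

definition inner_weight :: "real ^ 'n ^ 'n \<Rightarrow> 'n set \<Rightarrow> real" where
  "inner_weight R I = (\<Sum>i\<in>I. \<Sum>j\<in>I. R $ i $ j) / 2"

text \<open>
  The fractional orientations of \<open>R\<close>: \<open>B $ i $ j\<close> is the share of the weight of the pair \<open>i, j\<close>
  directed from \<open>i\<close> to \<open>j\<close>.  The diagonal of \<open>B\<close> is forced to be half of that of \<open>R\<close>.
\<close>

definition orientations :: "real ^ 'n ^ 'n \<Rightarrow> (real ^ 'n ^ 'n) set" where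
  "orientations R = {B. nonneg_matrix B \<and> R = B + transpose B}"

text \<open>The sum of the squared excesses of column sums over \<open>p\<close> and of row sums over \<open>q\<close>.\<close>

definition penalty :: "real \<Rightarrow> real \<Rightarrow> real ^ 'n ^ 'n \<Rightarrow> real" where
  "penalty p q B =
     (\<Sum>k\<in>UNIV. (max 0 (col_sum B k - p))\<^sup>2 + (max 0 (row_sum B k - q))\<^sup>2)"

text \<open>\<open>B\<close> with the amount \<open>t\<close> moved from the entry \<open>(i, j)\<close> to the entry \<open>(j, i)\<close>.\<close>

definition reverse_weight :: "'n \<Rightarrow> 'n \<Rightarrow> real \<Rightarrow> real ^ 'n ^ 'n \<Rightarrow> real ^ 'n ^ 'n" where
  "reverse_weight i j t B = (\<chi> k l. B $ k $ l
     + (if k = j then if l = i then t else 0 else 0)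
     - (if k = i then if l = j then t else 0 else 0))"

lemma orientations_nth:
  assumes "B \<in> orientations R"
  shows "R $ i $ j = B $ i $ j + B $ j $ i" "0 \<le> B $ i $ j"
  using assms by (auto simp: orientations_def nonneg_matrix_def transpose_def)

lemma row_sum_orientation:
  assumes "B \<in> orientations R"
  shows "row_sum R k = row_sum B k + col_sum B k"
  by (simp add: row_sum_def col_sum_def orientations_nth(1)[OF assms] sum.distrib)

lemma inner_weight_orientation:
  assumes "B \<in> orientations R"
  shows "inner_weight R I = (\<Sum>j\<in>I. \<Sum>i\<in>I. B $ i $ j)"
proof -
  have "(\<Sum>i\<in>I. \<Sum>j\<in>I. B $ j $ i) = (\<Sum>i\<in>I. \<Sum>j\<in>I. B $ i $ j)"
    by (rule sum.swap)
  then show ?thesis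
    by (simp add: inner_weight_def orientations_nth(1)[OF assms] sum.distrib)
qed

lemma inner_weight_le_col_sums:
  assumes "B \<in> orientations R"
  shows "inner_weight R I \<le> (\<Sum>k\<in>I. col_sum B k)"
  unfolding inner_weight_orientation[OF assms] col_sum_def
  by (intro sum_mono sum_mono2) (auto simp: orientations_nth(2)[OF assms])

lemma transpose_in_orientations:
  assumes "B \<in> orientations R"
  shows "transpose B \<in> orientations R"
  using assms by (auto simp: orientations_def nonneg_matrix_def transpose_def vec_eq_iff)

lemma col_sum_transpose: "col_sum (transpose B) k = row_sum B k"
  by (simp add: col_sum_def row_sum_def transpose_def)

lemma col_sums_closed_set:
  fixes I :: "'n::finite set"
  assumes B: "B \<in> orientations R"
    and closed: "\<And>i j. i \<notin> I \<Longrightarrow> j \<in> I \<Longrightarrow> B $ i $ j = 0"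
  shows "(\<Sum>k\<in>I. col_sum B k) = inner_weight R I"
  unfolding inner_weight_orientation[OF B] col_sum_def
  by (intro sum.cong refl sum.mono_neutral_right) (auto simp: closed)

lemma row_sums_closed_set:
  fixes I :: "'n::finite set"
  assumes B: "B \<in> orientations R"
    and closed: "\<And>i j. i \<in> I \<Longrightarrow> j \<notin> I \<Longrightarrow> B $ i $ j = 0"
  shows "(\<Sum>k\<in>I. row_sum B k) = inner_weight R I"
  using col_sums_closed_set[OF transpose_in_orientations[OF B], of I] closed
  by (simp add: col_sum_transpose) (simp add: transpose_def)

lemma compact_orientations: "compact (orientations R)"
proof -
  have "orientations R = {0..R} \<inter> {B. R = B + transpose B}"
    by (auto simp: orientations_def nonneg_matrix_def less_eq_vec_def transpose_def vec_eq_iff)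
  moreover have "closed {B. R = B + transpose B}"
    unfolding transpose_def by (intro closed_Collect_eq continuous_intros)
  ultimately show ?thesis
    by (simp add: compact_Int_closed)
qed

lemma orientations_nonempty:
  assumes "transpose R = R" "nonneg_matrix R"
  shows "orientations R \<noteq> {}"
proof -
  have "R $ j $ i = R $ i $ j" for i j
    using assms(1) by (metis transpose_def vec_lambda_beta)
  then have "(1/2) *\<^sub>R R \<in> orientations R"
    using assms(2) by (auto simp: orientations_def nonneg_matrix_def transpose_def vec_eq_iff)
  then show ?thesis by blast
qed

lemma continuous_on_penalty: "continuous_on S (penalty p q)"
  unfolding penalty_def col_sum_def row_sum_def by (intro continuous_intros)

lemma col_sum_reverse_weight:
  "col_sum (reverse_weight i j t B) k
    = col_sum B k + ((if k = i then t else 0) - (if k = j then t else 0))"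
  by (simp add: col_sum_def reverse_weight_def sum.distrib sum_subtractf)

lemma row_sum_reverse_weight:
  "row_sum (reverse_weight i j t B) k
    = row_sum B k + ((if k = j then t else 0) - (if k = i then t else 0))"
  by (simp add: row_sum_def reverse_weight_def sum.distrib sum_subtractf)

lemma reverse_weight_in_orientations:
  assumes "B \<in> orientations R" "i \<noteq> j" "0 \<le> t" "t \<le> B $ i $ j"
  shows "reverse_weight i j t B \<in> orientations R"
  using assms by (auto simp: orientations_def nonneg_matrix_def transpose_def vec_eq_iff
      reverse_weight_def add_nonneg_nonneg)

lemma square_pos_part_add_le:
  "(max 0 (x + t :: real))\<^sup>2 \<le> (max 0 x)\<^sup>2 + 2 * t * max 0 x + t\<^sup>2"
proof -
  have "(max 0 (x + t))\<^sup>2 \<le> (max 0 x + t)\<^sup>2"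
    by (cases "x + t \<le> 0") (auto intro!: power_mono)
  then show ?thesis by (simp add: power2_sum algebra_simps)
qed

text \<open>
  The penalty falls when weight is reversed from an end \<open>j\<close> with larger excess (column excess minus
  row excess) to an end \<open>i\<close> with smaller excess.
\<close>

lemma penalty_reverse_less:
  fixes B :: "real ^ 'n ^ 'n" and p q :: real
  defines "u \<equiv> \<lambda>k. max 0 (col_sum B k - p)"
    and "v \<equiv> \<lambda>k. max 0 (row_sum B k - q)"
  assumes "i \<noteq> j" "0 < t" and t: "2 * t < (u j - v j) - (u i - v i)"
  shows "penalty p q (reverse_weight i j t B) < penalty p q B"
proof -
  define e where "e k = (if k = i then t else 0) - (if k = j then t else 0)" for k
  have split: "(\<Sum>k\<in>UNIV. e k * f k) = t * (f i - f j)" for f :: "'n \<Rightarrow> real"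
    by (simp add: e_def left_diff_distrib sum_subtractf if_distrib[where f = "\<lambda>x. x * _"]
        right_diff_distrib cong: if_cong)
  have "penalty p q (reverse_weight i j t B)
      \<le> (\<Sum>k\<in>UNIV. (u k)\<^sup>2 + (v k)\<^sup>2 + 2 * (e k * (u k - v k)) + 2 * (e k * e k))"
    unfolding penalty_def
  proof (rule sum_mono)
    fix k
    have "(max 0 (col_sum B k - p + e k))\<^sup>2 \<le> (u k)\<^sup>2 + 2 * e k * u k + (e k)\<^sup>2"
      "(max 0 (row_sum B k - q + - e k))\<^sup>2 \<le> (v k)\<^sup>2 + 2 * (- e k) * v k + (- e k)\<^sup>2"
      unfolding u_def v_def by (rule square_pos_part_add_le)+
    moreover have eqs: "col_sum (reverse_weight i j t B) k - p = col_sum B k - p + e k"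
      "row_sum (reverse_weight i j t B) k - q = row_sum B k - q + - e k"
      by (auto simp: col_sum_reverse_weight row_sum_reverse_weight e_def)
    ultimately show "(max 0 (col_sum (reverse_weight i j t B) k - p))\<^sup>2
        + (max 0 (row_sum (reverse_weight i j t B) k - q))\<^sup>2
      \<le> (u k)\<^sup>2 + (v k)\<^sup>2 + 2 * (e k * (u k - v k)) + 2 * (e k * e k)"
      unfolding eqs right_diff_distrib power2_eq_square by linarith
  qed
  also have "\<dots> = penalty p q B + 2 * (t * ((u i - v i) - (u j - v j))) + 2 * (t * (e i - e j))"
    by (simp add: sum.distrib sum_distrib_left[symmetric] split penalty_def u_def v_def)
  also have "\<dots> = penalty p q B + 2 * t * (2 * t - ((u j - v j) - (u i - v i)))"
    using \<open>i \<noteq> j\<close> by (simp add: e_def algebra_simps)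
  also have "\<dots> < penalty p q B"
    using \<open>0 < t\<close> t by (simp add: mult_pos_neg)
  finally show ?thesis .
qed

text \<open>In a minimizer, weight is directed only towards vertices of no larger excess.\<close>

lemma penalty_minimizer_excess_le:
  fixes B :: "real ^ 'n ^ 'n" and p q :: real
  defines "u \<equiv> \<lambda>k. max 0 (col_sum B k - p)"
    and "v \<equiv> \<lambda>k. max 0 (row_sum B k - q)"
  assumes B: "B \<in> orientations R"
    and min: "\<And>B'. B' \<in> orientations R \<Longrightarrow> penalty p q B \<le> penalty p q B'"
    and pos: "B $ i $ j \<noteq> 0"
  shows "u j - v j \<le> u i - v i"
proof (rule ccontr)
  define d where "d = (u j - v j) - (u i - v i)"
  assume "\<not> ?thesis"
  then have d: "0 < d" and "i \<noteq> j" by (auto simp: d_def)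
  have "0 < B $ i $ j"
    using pos orientations_nth(2)[OF B, of i j] by simp
  \<comment> \<open>\<open>d / 3\<close> lies below the threshold \<open>d / 2\<close> of \<open>penalty_reverse_less\<close>.\<close>
  define t where "t = min (d / 3) (B $ i $ j)"
  have t: "0 < t" "t \<le> B $ i $ j" "2 * t < d"
    using d \<open>0 < B $ i $ j\<close> by (auto simp: t_def min_def)
  have "penalty p q (reverse_weight i j t B) < penalty p q B"
    using penalty_reverse_less[of i j t B p q] \<open>i \<noteq> j\<close> t(1,3)
    by (simp add: u_def v_def d_def)
  moreover have "reverse_weight i j t B \<in> orientations R"
    using reverse_weight_in_orientations[OF B \<open>i \<noteq> j\<close>] t by simp
  ultimately show False
    using min by fastforce
qed

lemma bounded_orientation_exists:
  fixes R :: "real ^ 'n ^ 'n" and p q :: real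
  assumes "transpose R = R" "nonneg_matrix R"
    and p: "\<And>I. inner_weight R I \<le> p * card I"
    and q: "\<And>I. inner_weight R I \<le> q * card I"
    and deg: "\<And>k. row_sum R k \<le> p + q"
  shows "\<exists>B \<in> orientations R. \<forall>k. col_sum B k \<le> p \<and> row_sum B k \<le> q"
proof -
  obtain B where B: "B \<in> orientations R"
    and min: "\<And>B'. B' \<in> orientations R \<Longrightarrow> penalty p q B \<le> penalty p q B'"
    using continuous_attains_inf[OF compact_orientations orientations_nonempty
        continuous_on_penalty] assms(1,2) by metis
  have excess: "max 0 (col_sum B j - p) - max 0 (row_sum B j - q)
      \<le> max 0 (col_sum B i - p) - max 0 (row_sum B i - q)" if "B $ i $ j \<noteq> 0" for i j
    using min that by (rule penalty_minimizer_excess_le[OF B])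
  have sum: "col_sum B k + row_sum B k \<le> p + q" for k
    using row_sum_orientation[OF B, of k] deg[of k] by simp
  have "col_sum B k \<le> p" for k
  proof (rule ccontr)
    define I where "I = {k. p < col_sum B k}"
    assume "\<not> col_sum B k \<le> p"
    \<comment> \<open>Vertices in \<open>I\<close> have positive excess (by \<open>sum\<close>, no row excess), all others at most zero.\<close>
    then have "I \<noteq> {}" by (auto simp: I_def not_le)
    have "B $ i $ j = 0" if "i \<notin> I" "j \<in> I" for i j
    proof (rule ccontr)
      assume "B $ i $ j \<noteq> 0"
      from excess[OF this] show False
        using that sum[of j] by (auto simp: I_def max_def split: if_splits)
    qed
    then have "(\<Sum>k\<in>I. col_sum B k) = inner_weight R I"
      by (rule col_sums_closed_set[OF B])
    moreover have "(\<Sum>k\<in>I. p) < (\<Sum>k\<in>I. col_sum B k)"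
      using \<open>I \<noteq> {}\<close> by (intro sum_strict_mono) (auto simp: I_def)
    ultimately show False
      using p[of I] by (simp add: mult.commute)
  qed
  moreover have "row_sum B k \<le> q" for k
  proof (rule ccontr)
    define I where "I = {k. q < row_sum B k}"
    assume "\<not> row_sum B k \<le> q"
    then have "I \<noteq> {}" by (auto simp: I_def not_le)
    have "B $ i $ j = 0" if "i \<in> I" "j \<notin> I" for i j
    proof (rule ccontr)
      assume "B $ i $ j \<noteq> 0"
      from excess[OF this] show False
        using that sum[of i] by (auto simp: I_def max_def split: if_splits)
    qed
    then have "(\<Sum>k\<in>I. row_sum B k) = inner_weight R I"
      by (rule row_sums_closed_set[OF B])
    moreover have "(\<Sum>k\<in>I. q) < (\<Sum>k\<in>I. row_sum B k)"
      using \<open>I \<noteq> {}\<close> by (intro sum_strict_mono) (auto simp: I_def)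
    ultimately show False
      using q[of I] by (simp add: mult.commute)
  qed
  ultimately show ?thesis
    using B by blast
qed

lemma matrix_norm_1_nonneg:
  assumes "nonneg_matrix A"
  shows "matrix_norm_1 A = (MAX j. col_sum A j)"
  using assms by (simp add: matrix_norm_1_def col_sum_def nonneg_matrix_def)

lemma matrix_norm_inf_nonneg:
  assumes "nonneg_matrix A"
  shows "matrix_norm_inf A = (MAX i. row_sum A i)"
  using assms by (simp add: matrix_norm_inf_def row_sum_def nonneg_matrix_def)

lemma max_density_alt:
  "max_density R = (MAX I \<in> {I. I \<noteq> {}}. inner_weight R I / card I)"
  by (simp add: max_density_def inner_weight_def)

lemma inner_weight_le_max_density:
  "inner_weight R I \<le> max_density R * card I"
proof (cases "I = {}")
  case False
  then have "inner_weight R I / card I \<le> max_density R"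
    unfolding max_density_alt by (intro Max_ge) auto
  then show ?thesis
    using False by (simp add: divide_le_eq card_gt_0_iff)
qed (simp add: inner_weight_def)

lemma max_density_attained:
  obtains I where "I \<noteq> {}" "inner_weight R I = max_density R * card I"
proof -
  have "max_density R \<in> (\<lambda>I. inner_weight R I / card I) ` {I. I \<noteq> {}}"
    unfolding max_density_alt by (intro Max_in) auto
  then obtain I where "I \<noteq> {}" "max_density R = inner_weight R I / card I"
    by auto
  then show ?thesis
    by (intro that[of I]) (auto simp: card_gt_0_iff)
qed

theorem lemma41:
  fixes R :: "real ^ 'n ^ 'n" and \<kappa> \<alpha> :: real
  assumes "transpose R = R"
    and "nonneg_matrix R"
    and "\<kappa> = max_density R"
    and "\<alpha> = matrix_norm_1 R"
  shows "\<exists>B :: real ^ 'n ^ 'n.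
           nonneg_matrix B \<and> R = B + transpose B \<and>
           matrix_norm_1 B = \<kappa> \<and> matrix_norm_inf B = \<alpha> - \<kappa>"
proof -
  have \<alpha>: "\<alpha> = (MAX k. row_sum R k)"
    using assms(4) matrix_norm_1_nonneg[OF assms(2)] col_sum_transpose[of R] assms(1) by simp
  have deg: "row_sum R k \<le> \<alpha>" for k
    unfolding \<alpha> by simp
  obtain k0 where k0: "row_sum R k0 = \<alpha>"
    using Max_in[of "range (row_sum R)"] unfolding \<alpha> by fastforce
  obtain I0 where I0: "I0 \<noteq> {}" "inner_weight R I0 = \<kappa> * card I0"
    using max_density_attained assms(3) by metis
  have dens: "inner_weight R I \<le> \<kappa> * card I" for I
    using inner_weight_le_max_density assms(3) by metis
  \<comment> \<open>The inner weight of a densest set is at most half its degree sum, which gives \<open>\<kappa> \<le> \<alpha> / 2\<close>.\<close>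
  have "inner_weight R I0 \<le> \<alpha> / 2 * card I0"
  proof -
    have "2 * inner_weight R I0 \<le> (\<Sum>k\<in>I0. row_sum R k)"
      unfolding inner_weight_def row_sum_def using assms(2)
      by (auto intro!: sum_mono sum_mono2 simp: nonneg_matrix_def)
    also have "\<dots> \<le> (\<Sum>k\<in>I0. \<alpha>)"
      by (intro sum_mono deg)
    finally show ?thesis by (simp add: mult.commute)
  qed
  then have "\<kappa> \<le> \<alpha> / 2"
    using I0 by (simp add: card_gt_0_iff)
  then have "\<kappa> * card I \<le> (\<alpha> - \<kappa>) * card I" for I :: "'n set"
    by (intro mult_right_mono) auto
  then have "inner_weight R I \<le> (\<alpha> - \<kappa>) * card I" for I
    using dens order_trans by blast
  then obtain B where B: "B \<in> orientations R"
    and col: "\<And>k. col_sum B k \<le> \<kappa>" and row: "\<And>k. row_sum B k \<le> \<alpha> - \<kappa>"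
    using bounded_orientation_exists[OF assms(1,2) dens, of "\<alpha> - \<kappa>"] deg by auto
  have nonneg: "nonneg_matrix B" and R: "R = B + transpose B"
    using B by (auto simp: orientations_def)
  have "\<exists>k. \<kappa> \<le> col_sum B k"
  proof (rule ccontr)
    assume "\<not> ?thesis"
    then have "(\<Sum>k\<in>I0. col_sum B k) < (\<Sum>k\<in>I0. \<kappa>)"
      using I0(1) by (intro sum_strict_mono) (auto simp: not_le)
    then show False
      using inner_weight_le_col_sums[OF B, of I0] I0(2) by (simp add: mult.commute)
  qed
  then obtain k1 where "col_sum B k1 = \<kappa>"
    using col antisym by blast
  then have "matrix_norm_1 B = \<kappa>"
    unfolding matrix_norm_1_nonneg[OF nonneg] using col by (intro Max_eqI) auto
  moreover have "row_sum B k0 = \<alpha> - \<kappa>"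
    using row_sum_orientation[OF B, of k0] k0 col[of k0] row[of k0] by simp
  then have "matrix_norm_inf B = \<alpha> - \<kappa>"
    unfolding matrix_norm_inf_nonneg[OF nonneg] using row by (intro Max_eqI) (auto intro: range_eqI sym)
  ultimately show ?thesis
    using nonneg R by blast
qed

end
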